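(* The global isotropy group of the category $\mathrm{Quandle}$ of quandles and quandle homomorphisms is the trivial group; that is, the only natural automorphism of the identity functor $\mathrm{Id}_{\mathrm{Quandle}}:\mathrm{Quandle}\to\mathrm{Quandle}$ is the identity natural transformation.
   Context: A quandle is a set with two binary operations $\lhd,\lhd^{-1}$ satisfying, for all $x,y,z$: $(x\lhd y)\lhd z=(x\lhd z)\lhd(y\lhd z)$; $(x\lhd^{-1}y)\lhd^{-1}z=(x\lhd^{-1}z)\lhd^{-1}(y\lhd^{-1}z)$; $(x\lhd y)\lhd^{-1}y=x$; $(x\lhd^{-1}y)\lhd y=x$; $x\lhd x=x$; $x\lhd^{-1}x=x$. The empty quandle is allowed. Quandle homomorphisms are maps preserving both operations. The global isotropy group of a category is the group of natural automorphisms of its identity functor. *)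

theory Defs
  imports "HOL-Algebra.Elementary_Groups" "HOL-Library.FuncSet"
begin

section \<open>Categories, functors, natural transformations\<close>

text \<open>Categories are given by hom-sets. An arrow value may lie in several hom-sets, so identities
  and composition carry their objects: \<open>Comp C X Y Z g f\<close> is $g \circ f$ for
  $f : X \to Y$ and $g : Y \to Z$.\<close>

record ('o, 'm) cat =
  Ob :: "'o set"
  Hom :: "'o \<Rightarrow> 'o \<Rightarrow> 'm set"
  Ide :: "'o \<Rightarrow> 'm"
  Comp :: "'o \<Rightarrow> 'o \<Rightarrow> 'o \<Rightarrow> 'm \<Rightarrow> 'm \<Rightarrow> 'm"

locale is_category =
  fixes C :: "('o, 'm) cat"
  assumes ide_in_hom: "X \<in> Ob C \<Longrightarrow> Ide C X \<in> Hom C X X"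
    and comp_in_hom:
      "\<lbrakk>X \<in> Ob C; Y \<in> Ob C; Z \<in> Ob C; f \<in> Hom C X Y; g \<in> Hom C Y Z\<rbrakk>
        \<Longrightarrow> Comp C X Y Z g f \<in> Hom C X Z"
    and comp_ide_right:
      "\<lbrakk>X \<in> Ob C; Y \<in> Ob C; f \<in> Hom C X Y\<rbrakk> \<Longrightarrow> Comp C X X Y f (Ide C X) = f"
    and comp_ide_left:
      "\<lbrakk>X \<in> Ob C; Y \<in> Ob C; f \<in> Hom C X Y\<rbrakk> \<Longrightarrow> Comp C X Y Y (Ide C Y) f = f"
    and comp_assoc:
      "\<lbrakk>W \<in> Ob C; X \<in> Ob C; Y \<in> Ob C; Z \<in> Ob C;
        f \<in> Hom C W X; g \<in> Hom C X Y; h \<in> Hom C Y Z\<rbrakk>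
        \<Longrightarrow> Comp C W X Z (Comp C X Y Z h g) f = Comp C W Y Z h (Comp C W X Y g f)"

definition iso_arrow :: "('o, 'm) cat \<Rightarrow> 'o \<Rightarrow> 'o \<Rightarrow> 'm \<Rightarrow> bool" where
  "iso_arrow C X Y f \<longleftrightarrow> f \<in> Hom C X Y \<and>
    (\<exists>g \<in> Hom C Y X. Comp C X Y X g f = Ide C X \<and> Comp C Y X Y f g = Ide C Y)"

record ('o1, 'm1, 'o2, 'm2) cat_map =
  FOb :: "'o1 \<Rightarrow> 'o2"
  FHom :: "'o1 \<Rightarrow> 'o1 \<Rightarrow> 'm1 \<Rightarrow> 'm2"

locale is_functor = C: is_category C + D: is_category D
  for C :: "('o1, 'm1) cat" and D :: "('o2, 'm2) cat" +
  fixes F :: "('o1, 'm1, 'o2, 'm2) cat_map"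
  assumes map_ob: "X \<in> Ob C \<Longrightarrow> FOb F X \<in> Ob D"
    and map_hom:
      "\<lbrakk>X \<in> Ob C; Y \<in> Ob C; f \<in> Hom C X Y\<rbrakk> \<Longrightarrow> FHom F X Y f \<in> Hom D (FOb F X) (FOb F Y)"
    and map_ide: "X \<in> Ob C \<Longrightarrow> FHom F X X (Ide C X) = Ide D (FOb F X)"
    and map_comp:
      "\<lbrakk>X \<in> Ob C; Y \<in> Ob C; Z \<in> Ob C; f \<in> Hom C X Y; g \<in> Hom C Y Z\<rbrakk>
        \<Longrightarrow> FHom F X Z (Comp C X Y Z g f)
          = Comp D (FOb F X) (FOb F Y) (FOb F Z) (FHom F Y Z g) (FHom F X Y f)"

definition id_functor :: "('o, 'm, 'o, 'm) cat_map" where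
  "id_functor = \<lparr>FOb = (\<lambda>X. X), FHom = (\<lambda>X Y f. f)\<rparr>"

text \<open>The family of components is required to be \<open>undefined\<close> off the objects of the source
  category, so that equality of natural transformations is equality of their components.\<close>

locale nat_trans = F: is_functor C D F + G: is_functor C D G
  for C :: "('o1, 'm1) cat" and D :: "('o2, 'm2) cat"
    and F G :: "('o1, 'm1, 'o2, 'm2) cat_map" +
  fixes \<alpha> :: "'o1 \<Rightarrow> 'm2"
  assumes component_ext: "\<alpha> \<in> extensional (Ob C)"
    and component_in_hom: "X \<in> Ob C \<Longrightarrow> \<alpha> X \<in> Hom D (FOb F X) (FOb G X)"
    and naturality:
      "\<lbrakk>X \<in> Ob C; Y \<in> Ob C; f \<in> Hom C X Y\<rbrakk>
        \<Longrightarrow> Comp D (FOb F X) (FOb F Y) (FOb G Y) (\<alpha> Y) (FHom F X Y f)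
          = Comp D (FOb F X) (FOb G X) (FOb G Y) (FHom G X Y f) (\<alpha> X)"

locale nat_iso = nat_trans +
  assumes component_iso: "X \<in> Ob C \<Longrightarrow> iso_arrow D (FOb F X) (FOb G X) (\<alpha> X)"

abbreviation nat_aut ::
    "('o1, 'm1) cat \<Rightarrow> ('o2, 'm2) cat \<Rightarrow> ('o1, 'm1, 'o2, 'm2) cat_map \<Rightarrow> ('o1 \<Rightarrow> 'm2) \<Rightarrow> bool" where
  "nat_aut C D F \<equiv> nat_iso C D F F"

definition id_nat_trans ::
    "('o1, 'm1) cat \<Rightarrow> ('o2, 'm2) cat \<Rightarrow> ('o1, 'm1, 'o2, 'm2) cat_map \<Rightarrow> 'o1 \<Rightarrow> 'm2" where
  "id_nat_trans C D F = (\<lambda>X \<in> Ob C. Ide D (FOb F X))"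

definition vertical_comp ::
    "('o1, 'm1) cat \<Rightarrow> ('o2, 'm2) cat \<Rightarrow>
      ('o1, 'm1, 'o2, 'm2) cat_map \<Rightarrow> ('o1, 'm1, 'o2, 'm2) cat_map \<Rightarrow> ('o1, 'm1, 'o2, 'm2) cat_map \<Rightarrow>
      ('o1 \<Rightarrow> 'm2) \<Rightarrow> ('o1 \<Rightarrow> 'm2) \<Rightarrow> 'o1 \<Rightarrow> 'm2" where
  "vertical_comp C D F G H \<beta> \<alpha> =
    (\<lambda>X \<in> Ob C. Comp D (FOb F X) (FOb G X) (FOb H X) (\<beta> X) (\<alpha> X))"

definition nat_aut_group ::
    "('o1, 'm1) cat \<Rightarrow> ('o2, 'm2) cat \<Rightarrow> ('o1, 'm1, 'o2, 'm2) cat_map \<Rightarrow> ('o1 \<Rightarrow> 'm2) monoid" where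
  "nat_aut_group C D F =
    \<lparr>carrier = {\<alpha>. nat_aut C D F \<alpha>}, mult = vertical_comp C D F F F, one = id_nat_trans C D F\<rparr>"

definition global_isotropy_group :: "('o, 'm) cat \<Rightarrow> ('o \<Rightarrow> 'm) monoid" where
  "global_isotropy_group C = nat_aut_group C C id_functor"

section \<open>Quandles\<close>

record 'a quandle = "'a partial_object" +
  qop :: "'a \<Rightarrow> 'a \<Rightarrow> 'a"  (infixl "\<triangleleft>\<index>" 70)
  qinv :: "'a \<Rightarrow> 'a \<Rightarrow> 'a"  (infixl "\<triangleleft>\<inverse>\<index>" 70)

locale is_quandle =
  fixes Q :: "'a quandle" (structure)
  assumes qop_closed: "\<lbrakk>x \<in> carrier Q; y \<in> carrier Q\<rbrakk> \<Longrightarrow> x \<triangleleft> y \<in> carrier Q"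
    and qinv_closed: "\<lbrakk>x \<in> carrier Q; y \<in> carrier Q\<rbrakk> \<Longrightarrow> x \<triangleleft>\<inverse> y \<in> carrier Q"
    and qop_distrib:
      "\<lbrakk>x \<in> carrier Q; y \<in> carrier Q; z \<in> carrier Q\<rbrakk>
        \<Longrightarrow> (x \<triangleleft> y) \<triangleleft> z = (x \<triangleleft> z) \<triangleleft> (y \<triangleleft> z)"
    and qinv_distrib:
      "\<lbrakk>x \<in> carrier Q; y \<in> carrier Q; z \<in> carrier Q\<rbrakk>
        \<Longrightarrow> (x \<triangleleft>\<inverse> y) \<triangleleft>\<inverse> z = (x \<triangleleft>\<inverse> z) \<triangleleft>\<inverse> (y \<triangleleft>\<inverse> z)"
    and qop_qinv: "\<lbrakk>x \<in> carrier Q; y \<in> carrier Q\<rbrakk> \<Longrightarrow> (x \<triangleleft> y) \<triangleleft>\<inverse> y = x"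
    and qinv_qop: "\<lbrakk>x \<in> carrier Q; y \<in> carrier Q\<rbrakk> \<Longrightarrow> (x \<triangleleft>\<inverse> y) \<triangleleft> y = x"
    and qop_idem: "x \<in> carrier Q \<Longrightarrow> x \<triangleleft> x = x"
    and qinv_idem: "x \<in> carrier Q \<Longrightarrow> x \<triangleleft>\<inverse> x = x"

text \<open>Homomorphisms are \<open>undefined\<close> off the carrier, so that equality of arrows is equality of
  maps on the carrier.\<close>

definition quandle_hom :: "'a quandle \<Rightarrow> 'b quandle \<Rightarrow> ('a \<Rightarrow> 'b) set" where
  "quandle_hom Q R = {f \<in> carrier Q \<rightarrow>\<^sub>E carrier R.
    \<forall>x \<in> carrier Q. \<forall>y \<in> carrier Q.
      f (x \<triangleleft>\<^bsub>Q\<^esub> y) = f x \<triangleleft>\<^bsub>R\<^esub> f y \<and> f (x \<triangleleft>\<inverse>\<^bsub>Q\<^esub> y) = f x \<triangleleft>\<inverse>\<^bsub>R\<^esub> f y}"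

text \<open>The ambient type \<open>'a\<close> plays the role of the universe: the objects are all quandles, the
  empty one included, whose carrier is a subset of \<open>'a\<close>. As usual for carrier-based structures,
  records that differ only in the values of the operations off the carrier are different objects;
  they are isomorphic through the identity map of the carrier.\<close>

definition Quandle :: "('a quandle, 'a \<Rightarrow> 'a) cat" where
  "Quandle =
    \<lparr>Ob = {Q. is_quandle Q},
     Hom = quandle_hom,
     Ide = (\<lambda>Q. \<lambda>x \<in> carrier Q. x),
     Comp = (\<lambda>Q R S g f. compose (carrier Q) g f)\<rparr>"

lemma is_category_Quandle: "is_category (Quandle :: ('a quandle, 'a \<Rightarrow> 'a) cat)"
proof
  fix X Y Z :: "'a quandle" and f g :: "'a \<Rightarrow> 'a"
  assume "X \<in> Ob Quandle" "f \<in> Hom Quandle X Y" "g \<in> Hom Quandle Y Z"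
  then show "Comp Quandle X Y Z g f \<in> Hom Quandle X Z"
    by (auto simp: Quandle_def quandle_hom_def compose_def PiE_iff is_quandle_def)
next
  fix W X Y Z :: "'a quandle" and f g h :: "'a \<Rightarrow> 'a"
  assume "f \<in> Hom Quandle W X"
  then show "Comp Quandle W X Z (Comp Quandle X Y Z h g) f
      = Comp Quandle W Y Z h (Comp Quandle W X Y g f)"
    by (auto simp: Quandle_def quandle_hom_def compose_def PiE_iff fun_eq_iff)
qed (auto simp: Quandle_def quandle_hom_def compose_def PiE_iff is_quandle_def
    fun_eq_iff extensional_def)

lemma is_functor_id: "is_category C \<Longrightarrow> is_functor C C id_functor"
  by (simp add: is_functor_def is_functor_axioms_def id_functor_def is_category.comp_in_hom)

end

theory Submission
  imports Defs
begin

text \<open>By idempotence every element \<open>x\<close> of a quandle \<open>Q\<close> spans a one-element subquandle, on which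
  every endomorphism is the identity. Naturality with respect to the inclusion of this subquandle
  forces each natural endomorphism of the identity functor to fix \<open>x\<close>.\<close>

lemma is_quandle_singleton:
  assumes "is_quandle Q" and "x \<in> carrier Q"
  shows "is_quandle (Q\<lparr>carrier := {x}\<rparr>)"
  using assms by (auto simp: is_quandle_def)

lemma singleton_inclusion_hom:
  assumes "is_quandle Q" and "x \<in> carrier Q"
  shows "(\<lambda>y \<in> {x}. y) \<in> quandle_hom (Q\<lparr>carrier := {x}\<rparr>) Q"
  using assms by (auto simp: quandle_hom_def is_quandle_def)

lemma nat_trans_id_Quandle_unique:
  fixes \<alpha> :: "'a quandle \<Rightarrow> 'a \<Rightarrow> 'a"
  assumes "nat_trans Quandle Quandle id_functor id_functor \<alpha>"
  shows "\<alpha> = id_nat_trans Quandle Quandle id_functor"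
proof -
  interpret nat_trans Quandle Quandle id_functor id_functor \<alpha> by fact
  have hom: "\<alpha> Q \<in> quandle_hom Q Q" if "is_quandle Q" for Q
    using component_in_hom[of Q] that by (simp add: Quandle_def id_functor_def)
  have fixes_all: "\<alpha> Q x = x" if Q: "is_quandle Q" and x: "x \<in> carrier Q" for Q x
  proof -
    let ?S = "Q\<lparr>carrier := {x}\<rparr>" and ?i = "\<lambda>y \<in> {x}. y"
    have S: "is_quandle ?S"
      using Q x by (rule is_quandle_singleton)
    have "compose {x} (\<alpha> Q) ?i = compose {x} ?i (\<alpha> ?S)"
      using naturality[of ?S Q ?i] Q S singleton_inclusion_hom[OF Q x]
      by (simp add: Quandle_def id_functor_def)
    \<comment> \<open>The outer \<open>?i\<close> can be removed only once
      \<open>\<alpha> ?S x\<close> is known to lie in \<open>{x}\<close>, because \<open>?i\<close>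
      is \<open>undefined\<close> elsewhere.\<close>
    then have "\<alpha> Q x = ?i (\<alpha> ?S x)"
      by (auto simp: compose_def dest: fun_cong[of _ _ x])
    moreover have "\<alpha> ?S x = x"
      using hom[OF S] by (auto simp: quandle_hom_def)
    ultimately show ?thesis
      by simp
  qed
  \<comment> \<open>Values on the carrier determine \<open>\<alpha> Q\<close>, since homomorphisms
    are extensional.\<close>
  have "\<alpha> Q = (\<lambda>x \<in> carrier Q. x)" if "is_quandle Q" for Q
    using hom[OF that] fixes_all[OF that]
    by (auto simp: quandle_hom_def fun_eq_iff PiE_iff extensional_def)
  \<comment> \<open>Off the objects both families are \<open>undefined\<close>, the left one by
    \<open>component_ext\<close>.\<close>
  then show ?thesis
    using component_ext
    by (auto simp: id_nat_trans_def Quandle_def id_functor_def fun_eq_iff extensional_def)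
qed

text \<open>The unit laws give naturality as well as invertibility, each component being its own
  inverse. This is the existence half of the final equivalence.\<close>

lemma nat_aut_id_nat_trans:
  assumes "is_functor C D F"
  shows "nat_aut C D F (id_nat_trans C D F)"
proof -
  interpret is_functor C D F by fact
  show ?thesis
    by unfold_locales
      (auto simp: id_nat_trans_def iso_arrow_def D.ide_in_hom D.comp_ide_left D.comp_ide_right
        map_ob map_hom intro!: bexI[of _ "Ide D (FOb F X)" for X])
qed

lemma vertical_comp_id_nat_trans:
  assumes "is_functor C D F"
  shows "vertical_comp C D F F F (id_nat_trans C D F) (id_nat_trans C D F) = id_nat_trans C D F"
proof -
  interpret is_functor C D F by fact
  show ?thesis
    by (auto simp: vertical_comp_def id_nat_trans_def D.comp_ide_left D.ide_in_hom map_ob)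
qed

text \<open>Once the carrier is a singleton, every group axiom reduces to the product of the
  identity with itself, so associativity of general vertical composition never has to be
  established.\<close>

lemma trivial_group_nat_aut_group:
  assumes "is_functor C D F"
    and "\<And>\<alpha>. nat_aut C D F \<alpha> \<Longrightarrow> \<alpha> = id_nat_trans C D F"
  shows "trivial_group (nat_aut_group C D F)"
proof -
  have "{\<alpha>. nat_aut C D F \<alpha>} = {id_nat_trans C D F}"
    using assms nat_aut_id_nat_trans by blast
  then show ?thesis
    unfolding trivial_group_def nat_aut_group_def
    by (auto intro!: groupI simp: vertical_comp_id_nat_trans[OF assms(1)])
qed

theorem corollary3p7:
  shows "trivial_group (global_isotropy_group (Quandle :: ('a quandle, 'a \<Rightarrow> 'a) cat))
    \<and> (\<forall>\<alpha>. nat_aut (Quandle :: ('a quandle, 'a \<Rightarrow> 'a) cat) Quandle id_functor \<alpha>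
          \<longleftrightarrow> \<alpha> = id_nat_trans Quandle Quandle id_functor)"
proof -
  let ?C = "Quandle :: ('a quandle, 'a \<Rightarrow> 'a) cat"
  have F: "is_functor ?C ?C id_functor"
    by (rule is_functor_id[OF is_category_Quandle])
  \<comment> \<open>Forgetting invertibility turns the automorphism into a natural endomorphism,
    which is already known to be the identity.\<close>
  have unique: "\<alpha> = id_nat_trans ?C ?C id_functor" if "nat_aut ?C ?C id_functor \<alpha>" for \<alpha>
    using that by (intro nat_trans_id_Quandle_unique) (rule nat_iso.axioms(1))
  show ?thesis
    unfolding global_isotropy_group_def
    using trivial_group_nat_aut_group[OF F unique] unique nat_aut_id_nat_trans[OF F] by blast
qed

end
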